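(* There is a parameterized reduction from the parameterized Independent Set problem to the parameterized 0-1 Timed Matching problem. Here parameterized Independent Set asks: given a static graph $G=(V,E)$ and an integer $k$ (the parameter), is there a set $I\subseteq V$ with $|I|=k$ such that no two vertices of $I$ are adjacent? Parameterized 0-1 Timed Matching asks: given a temporal graph $\mathcal{G}=(\mathcal{V},\mathcal{E})$ and an integer $k'$ (the parameter), is there a set $M\subseteq\mathcal{E}$ with $|M|=k'$ such that no two edges of $M$ overlap?
   Context: A temporal graph $\mathcal{G}=(\mathcal{V},\mathcal{E})$ with lifetime $\mathcal{T}$ has a fixed finite vertex set $\mathcal{V}$. Each edge $e\in\mathcal{E}$ joins two distinct vertices $u,v$ and is given as $e(u,v,(s_1,f_1),\dots,(s_k,f_k))$ with pairwise non-overlapping integer intervals, $0\le s_i<f_i\le\mathcal{T}$, meaning $e$ exists exactly at the integer timesteps in $\bigcup_i[s_i,f_i)$. There are no self-loops, and at most one edge joins any pair of vertices. Two edges $e_{uv},e_{vw}\in\mathcal{E}$ overlap if they share a common endpoint $v$ and there is at least one timestep $t$ at which both exist. A parameterized reduction from $(A,\kappa)$ to $(B,\kappa')$ is an algorithm mapping an instance $(x,k)$ to an instance $(x',k')$ in time $f(k)\cdot|x|^{O(1)}$ such that $(x,k)$ is a yes-instance iff $(x',k')$ is, and $k'\le g(k)$ for some computable functions $f,g$. *)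

theory Defs
  imports "HOL-Library.Ramsey" "HOL-Library.Disjoint_Sets"
begin

section \<open>Algorithms and their running time\<close>

text \<open>
  Algorithms are structured programs that operate on finitely many stacks over a fixed finite
  alphabet. One elementary step pushes a fixed symbol, pops a symbol, or branches on the topmost
  symbol of a stack. A Turing machine tape is a pair of stacks and a stack is a one-way infinite
  tape whose head stays at the end of its content, so this model and deterministic multitape
  Turing machines simulate each other with a constant-factor overhead. In particular both define
  the same computable functions and, up to constant factors, the same running times.
\<close>

datatype symbol = Zero | One | Open | Close

type_synonym word = "symbol list"

type_synonym store = "nat \<Rightarrow> word"

datatype com =
    SKIP
  | PUSH nat symbol
  | POP nat
  | SEQ com com
  | IF nat "symbol option set" com com
  | WHILE nat "symbol option set" com

text \<open>The value \<^term>\<open>None\<close> signals an empty stack.\<close>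

definition top_symbol :: "word \<Rightarrow> symbol option" where
  "top_symbol w = (case w of [] \<Rightarrow> None | a # _ \<Rightarrow> Some a)"

text \<open>
  \<open>run c s t s'\<close>: started in store \<open>s\<close>, program \<open>c\<close> halts after \<open>t\<close> steps in store \<open>s'\<close>.
\<close>

inductive run :: "com \<Rightarrow> store \<Rightarrow> nat \<Rightarrow> store \<Rightarrow> bool" where
  Skip: "run SKIP s 1 s"
| Push: "run (PUSH i a) s 1 (s(i := a # s i))"
| Pop: "run (POP i) s 1 (s(i := tl (s i)))"
| Seq: "run c1 s m s' \<Longrightarrow> run c2 s' n s'' \<Longrightarrow> run (SEQ c1 c2) s (m + n) s''"
| IfTrue: "top_symbol (s i) \<in> A \<Longrightarrow> run c1 s m s' \<Longrightarrow> run (IF i A c1 c2) s (1 + m) s'"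
| IfFalse: "top_symbol (s i) \<notin> A \<Longrightarrow> run c2 s m s' \<Longrightarrow> run (IF i A c1 c2) s (1 + m) s'"
| WhileTrue: "top_symbol (s i) \<in> A \<Longrightarrow> run c s m s' \<Longrightarrow> run (WHILE i A c) s' n s''
    \<Longrightarrow> run (WHILE i A c) s (1 + m + n) s''"
| WhileFalse: "top_symbol (s i) \<notin> A \<Longrightarrow> run (WHILE i A c) s 1 s"

text \<open>
  The input words are placed on the first stacks and all other stacks are initially empty;
  the output words are read off the first stacks, and the other stacks are ignored.
\<close>

definition input_store :: "word list \<Rightarrow> store" where
  "input_store ws = (\<lambda>i. if i < length ws then ws ! i else [])"

definition computes_in :: "com \<Rightarrow> word list \<Rightarrow> word list \<Rightarrow> nat \<Rightarrow> bool" where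
  "computes_in P ins outs t \<longleftrightarrow>
     (\<exists>s. run P (input_store ins) t s \<and> (\<forall>i<length outs. s i = outs ! i))"

text \<open>Binary representation with the least significant bit first; zero is the empty word.\<close>

fun bin :: "nat \<Rightarrow> word" where
  "bin n = (if n = 0 then [] else (if odd n then One else Zero) # bin (n div 2))"

declare bin.simps [simp del]

definition computable :: "(nat \<Rightarrow> nat) \<Rightarrow> bool" where
  "computable f \<longleftrightarrow> (\<exists>P. \<forall>n. \<exists>t. computes_in P [bin n] [bin (f n)] t)"


section \<open>Parameterized problems and reductions\<close>

text \<open>An instance is a word together with its parameter.\<close>

record param_problem =
  instances :: "(word \<times> nat) set"
  yes_instances :: "(word \<times> nat) set"

definition parameterized_reduction :: "com \<Rightarrow> param_problem \<Rightarrow> param_problem \<Rightarrow> bool" where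
  "parameterized_reduction P A B \<longleftrightarrow>
     (\<exists>f g c. computable f \<and> computable g \<and>
       (\<forall>(x, k) \<in> instances A. \<exists>x' k' t.
          computes_in P [x, bin k] [x', bin k'] t \<and>
          t \<le> f k * length x ^ c \<and>
          (x', k') \<in> instances B \<and>
          ((x, k) \<in> yes_instances A \<longleftrightarrow> (x', k') \<in> yes_instances B) \<and>
          k' \<le> g k))"


section \<open>Words encoding structured data\<close>

definition enc_nat :: "nat \<Rightarrow> word" where
  "enc_nat n = Open # bin n @ [Close]"

definition enc_pair :: "('a \<Rightarrow> word) \<Rightarrow> ('b \<Rightarrow> word) \<Rightarrow> 'a \<times> 'b \<Rightarrow> word" where
  "enc_pair f g = (\<lambda>(x, y). f x @ g y)"

definition enc_list :: "('a \<Rightarrow> word) \<Rightarrow> 'a list \<Rightarrow> word" where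
  "enc_list f xs = Open # concat (map f xs) @ [Close]"


section \<open>Independent Set\<close>

definition static_graph :: "'v set \<Rightarrow> 'v set set \<Rightarrow> bool" where
  "static_graph V E \<longleftrightarrow> finite V \<and> E \<subseteq> nsets V 2"

definition has_independent_set :: "'v set \<Rightarrow> 'v set set \<Rightarrow> nat \<Rightarrow> bool" where
  "has_independent_set V E k \<longleftrightarrow> (\<exists>I\<subseteq>V. card I = k \<and> indep I E)"

text \<open>
  A graph is written down by listing its vertices (named by numbers in binary) and its edges,
  in any order and each of them once.
\<close>

definition encodes_graph :: "word \<Rightarrow> nat set \<Rightarrow> nat set set \<Rightarrow> bool" where
  "encodes_graph w V E \<longleftrightarrow>
     (\<exists>vs es. distinct vs \<and> set vs = V \<and>
        distinct (map (\<lambda>(u, v). {u, v}) es) \<and> set (map (\<lambda>(u, v). {u, v}) es) = E \<and>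
        w = enc_pair (enc_list enc_nat) (enc_list (enc_pair enc_nat enc_nat)) (vs, es))"

definition independent_set_problem :: param_problem where
  "independent_set_problem =
     \<lparr>instances = {(w, k). \<exists>V E. static_graph V E \<and> encodes_graph w V E},
      yes_instances = {(w, k). \<exists>V E. static_graph V E \<and> encodes_graph w V E \<and>
        has_independent_set V E k}\<rparr>"


section \<open>0-1 Timed Matching\<close>

text \<open>
  The tuple \<open>(u, v, [(s\<^sub>1, f\<^sub>1), \<dots>, (s\<^sub>k, f\<^sub>k)])\<close> is the edge joining \<open>u\<close> and \<open>v\<close> that exists
  exactly at the timesteps in the half-open intervals from \<open>s\<^sub>i\<close> to \<open>f\<^sub>i\<close>.
\<close>

type_synonym 'v tedge = "'v \<times> 'v \<times> (nat \<times> nat) list"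

fun ends :: "'v tedge \<Rightarrow> 'v set" where
  "ends (u, v, Is) = {u, v}"

fun timesteps :: "'v tedge \<Rightarrow> nat set" where
  "timesteps (u, v, Is) = (\<Union>(s, f) \<in> set Is. {s..<f})"

definition valid_intervals :: "nat \<Rightarrow> (nat \<times> nat) list \<Rightarrow> bool" where
  "valid_intervals T Is \<longleftrightarrow> Is \<noteq> [] \<and> (\<forall>(s, f) \<in> set Is. s < f \<and> f \<le> T) \<and>
     disjoint_family_on (\<lambda>i. {fst (Is ! i)..<snd (Is ! i)}) {..<length Is}"

definition temporal_graph :: "'v set \<Rightarrow> 'v tedge set \<Rightarrow> nat \<Rightarrow> bool" where
  "temporal_graph V E T \<longleftrightarrow> finite V \<and>
     (\<forall>(u, v, Is) \<in> E. u \<in> V \<and> v \<in> V \<and> u \<noteq> v \<and> valid_intervals T Is) \<and>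
     inj_on ends E"

definition overlap :: "'v tedge \<Rightarrow> 'v tedge \<Rightarrow> bool" where
  "overlap e e' \<longleftrightarrow> ends e \<inter> ends e' \<noteq> {} \<and> (\<exists>t. t \<in> timesteps e \<and> t \<in> timesteps e')"

definition timed_matching :: "'v tedge set \<Rightarrow> 'v tedge set \<Rightarrow> bool" where
  "timed_matching E M \<longleftrightarrow> M \<subseteq> E \<and> pairwise (\<lambda>e e'. \<not> overlap e e') M"

definition has_timed_matching :: "'v tedge set \<Rightarrow> nat \<Rightarrow> bool" where
  "has_timed_matching E k \<longleftrightarrow> (\<exists>M. timed_matching E M \<and> card M = k)"

definition enc_tedge :: "nat tedge \<Rightarrow> word" where
  "enc_tedge = enc_pair enc_nat (enc_pair enc_nat (enc_list (enc_pair enc_nat enc_nat)))"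

definition encodes_temporal_graph :: "word \<Rightarrow> nat set \<Rightarrow> nat tedge set \<Rightarrow> nat \<Rightarrow> bool" where
  "encodes_temporal_graph w V E T \<longleftrightarrow>
     (\<exists>vs es. distinct vs \<and> set vs = V \<and> distinct es \<and> set es = E \<and>
        w = enc_pair enc_nat (enc_pair (enc_list enc_nat) (enc_list enc_tedge)) (T, vs, es))"

definition timed_matching_problem :: param_problem where
  "timed_matching_problem =
     \<lparr>instances = {(w, k). \<exists>V E T. temporal_graph V E T \<and> encodes_temporal_graph w V E T},
      yes_instances = {(w, k). \<exists>V E T. temporal_graph V E T \<and> encodes_temporal_graph w V E T \<and>
        has_timed_matching E k}\<rparr>"

end

(* A graph G is sent to a star. The leaf edge of a vertex v exists during the interval
   [2^j, 2^(j+1)) for every group j containing v, where the groups are the edges of G and, to give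
   isolated vertices a timestep, the singletons {v}. All leaf edges share the centre, so two of them
   overlap iff some group contains both vertices, that is, iff the vertices are adjacent. Hence
   independent sets of size k correspond to matchings of size k and the parameter is unchanged.
   The centre is named 0 and the leaf of v is named 2v+1, and the endpoints of the intervals are
   powers of two: in binary these are written by pushing constants and copying words, so that the
   program never does arithmetic. *)

theory Submission
  imports Defs
begin

section \<open>Running time of programs\<close>

text \<open>The time bound is part of the claim, so the reduction is an explicit stack program with
  a proved step count. Moving a word between stacks reverses it; this is why the output is written
  from its end and why pushed constants read backwards. Which groups contain a vertex is found by
  comparing names bit by bit in one scan of the whole group list per vertex, which leads to a cubic
  bound. The timesteps are exponential in the number of groups, but their binary words have linear
  length. The lifetime only has to bound every interval end, so it is \<open>2 ^ L\<close> for the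
  length \<open>L\<close> of the stored group list: its word arises by turning each symbol of that
  list into \<open>Zero\<close>, without counting groups.\<close>

lemma top_symbol_simps [simp]: "top_symbol [] = None" "top_symbol (a # w) = Some a"
  by (simp_all add: top_symbol_def)

text \<open>An upper bound rather than an exact count, so that branches of different cost share one
  bound and \<open>exec_mono\<close> can round bounds up to simple terms.\<close>

definition exec :: "com \<Rightarrow> store \<Rightarrow> nat \<Rightarrow> store \<Rightarrow> bool" where
  "exec c s n s' \<longleftrightarrow> (\<exists>t\<le>n. run c s t s')"

lemma exec_mono: "exec c s m s' \<Longrightarrow> m \<le> n \<Longrightarrow> exec c s n s'"
  unfolding exec_def using le_trans by blast

lemma exec_SKIP: "exec SKIP s (Suc 0) s"
  unfolding exec_def using run.Skip by fastforce

lemma exec_PUSH: "exec (PUSH i a) s (Suc 0) (s(i := a # s i))"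
  unfolding exec_def using run.Push by fastforce

lemma exec_POP: "exec (POP i) s (Suc 0) (s(i := tl (s i)))"
  unfolding exec_def using run.Pop by fastforce

lemma exec_SEQ:
  assumes "exec c1 s m s'" "exec c2 s' n s''"
  shows "exec (SEQ c1 c2) s (m + n) s''"
proof -
  obtain t1 t2 where "t1 \<le> m" "run c1 s t1 s'" "t2 \<le> n" "run c2 s' t2 s''"
    using assms unfolding exec_def by blast
  then show ?thesis
    unfolding exec_def by (intro exI[of _ "t1 + t2"]) (auto intro: run.Seq)
qed

lemma exec_IF_True:
  assumes "top_symbol (s i) \<in> A" "exec c1 s n s'"
  shows "exec (IF i A c1 c2) s (Suc n) s'"
proof -
  obtain t where "t \<le> n" "run c1 s t s'"
    using assms unfolding exec_def by blast
  then have "run (IF i A c1 c2) s (1 + t) s'" using assms by (intro run.IfTrue)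
  then show ?thesis unfolding exec_def using \<open>t \<le> n\<close> by (intro exI[of _ "1 + t"]) auto
qed

lemma exec_IF_False:
  assumes "top_symbol (s i) \<notin> A" "exec c2 s n s'"
  shows "exec (IF i A c1 c2) s (Suc n) s'"
proof -
  obtain t where "t \<le> n" "run c2 s t s'"
    using assms unfolding exec_def by blast
  then have "run (IF i A c1 c2) s (1 + t) s'" using assms by (intro run.IfFalse)
  then show ?thesis unfolding exec_def using \<open>t \<le> n\<close> by (intro exI[of _ "1 + t"]) auto
qed

lemma exec_WHILE_step:
  assumes "top_symbol (s i) \<in> A" "exec c s m s'" "exec (WHILE i A c) s' n s''"
  shows "exec (WHILE i A c) s (Suc (m + n)) s''"
proof -
  obtain t1 t2 where "t1 \<le> m" "run c s t1 s'" "t2 \<le> n" "run (WHILE i A c) s' t2 s''"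
    using assms unfolding exec_def by blast
  moreover from this have "run (WHILE i A c) s (1 + t1 + t2) s''"
    using assms by (intro run.WhileTrue)
  ultimately show ?thesis
    unfolding exec_def by (intro exI[of _ "1 + t1 + t2"]) auto
qed

lemma exec_WHILE_stop: "top_symbol (s i) \<notin> A \<Longrightarrow> exec (WHILE i A c) s (Suc 0) s"
  unfolding exec_def using run.WhileFalse by fastforce

section \<open>Instruction sequences and loops that consume a stack\<close>

fun block :: "com list \<Rightarrow> com" where
  "block [] = SKIP"
| "block (c # cs) = SEQ c (block cs)"

lemma exec_block_Cons:
  "exec c s m s' \<Longrightarrow> exec (block cs) s' n s'' \<Longrightarrow> exec (block (c # cs)) s (m + n) s''"
  by (simp add: exec_SEQ)

text \<open>The last symbol of \<open>w\<close> ends up on top, so the constants passed to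
  \<open>put\<close> read backwards in the output.\<close>

definition put :: "nat \<Rightarrow> word \<Rightarrow> com" where
  "put i w = block (map (PUSH i) w)"

lemma exec_put: "exec (put i w) s (Suc (length w)) (s(i := rev w @ s i))"
proof (induction w arbitrary: s)
  case Nil
  then show ?case using exec_SKIP by (simp add: put_def)
next
  case (Cons a w)
  from exec_SEQ[OF exec_PUSH[of i a s] Cons.IH[of "s(i := a # s i)"]]
  show ?case
    by (simp only: put_def fun_upd_upd fun_upd_same list.map block.simps list.size rev.simps
        append_assoc append_Cons append_Nil add_Suc add_0 add_Suc_right add_0_right)
qed

text \<open>A program has no variable for the symbol it pops; the four-way branch simulates a body
  \<open>f\<close> depending on it. The last branch stands for \<open>Close\<close>, so
  \<open>A\<close> is meant not to contain \<open>None\<close>.\<close>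

definition each :: "nat \<Rightarrow> symbol option set \<Rightarrow> (symbol \<Rightarrow> com) \<Rightarrow> com" where
  "each i A f = WHILE i A
     (IF i {Some Zero} (SEQ (POP i) (f Zero))
     (IF i {Some One} (SEQ (POP i) (f One))
     (IF i {Some Open} (SEQ (POP i) (f Open)) (SEQ (POP i) (f Close)))))"

text \<open>The 5 extra steps are one loop test, at most three branches and one pop.\<close>

lemma exec_each_step:
  assumes "s i = a # w" "Some a \<in> A" "exec (f a) (s(i := w)) m s'" "exec (each i A f) s' n s''"
  shows "exec (each i A f) s (m + n + 5) s''"
proof -
  have *: "exec (SEQ (POP i) (f a)) s (1 + m) s'"
    by (rule exec_SEQ) (use exec_POP[of i s] assms in auto)
  have "exec (IF i {Some Zero} (SEQ (POP i) (f Zero))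
     (IF i {Some One} (SEQ (POP i) (f One))
     (IF i {Some Open} (SEQ (POP i) (f Open)) (SEQ (POP i) (f Close))))) s (4 + m) s'"
  proof (cases a)
    case Zero
    show ?thesis
      by (rule exec_mono[OF exec_IF_True[OF _ *[unfolded Zero]]])
        (use assms(1) in \<open>simp_all add: Zero\<close>)
  next
    case One
    show ?thesis
      by (rule exec_mono[OF exec_IF_False[OF _ exec_IF_True[OF _ *[unfolded One]]]])
        (use assms(1) in \<open>simp_all add: One\<close>)
  next
    case Open
    show ?thesis
      by (rule exec_mono[OF exec_IF_False[OF _ exec_IF_False[OF _ exec_IF_True[OF _ *[unfolded Open]]]]])
        (use assms(1) in \<open>simp_all add: Open\<close>)
  next
    case Close
    show ?thesis
      by (rule exec_mono[OF exec_IF_False[OF _ exec_IF_False[OF _ exec_IF_False[OF _ *[unfolded Close]]]]])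
        (use assms(1) in \<open>simp_all add: Close\<close>)
  qed
  from exec_WHILE_step[OF _ this assms(4)[unfolded each_def]] assms(1,2) show ?thesis
    unfolding each_def by (auto elim!: exec_mono)
qed

lemma exec_each_stop: "top_symbol (s i) \<notin> A \<Longrightarrow> exec (each i A f) s (Suc 0) s"
  unfolding each_def by (rule exec_WHILE_stop)

text \<open>An empty \<open>js\<close> gives erasure, several targets give copying; each target
  receives the concatenated words \<open>g a\<close> in reverse.\<close>

definition transduce ::
  "nat \<Rightarrow> symbol option set \<Rightarrow> (symbol \<Rightarrow> word) \<Rightarrow> nat list \<Rightarrow> com" where
  "transduce i A g js = each i A (\<lambda>a. block (map (\<lambda>j. put j (g a)) js))"

lemma exec_puts:
  assumes "distinct js"
  shows "exec (block (map (\<lambda>j. put j w) js)) s (Suc (length js * Suc (length w)))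
    (\<lambda>j. if j \<in> set js then rev w @ s j else s j)"
  using assms
proof (induction js arbitrary: s)
  case Nil
  then show ?case using exec_SKIP by simp
next
  case (Cons i js)
  have "(\<lambda>j. if j \<in> set js then rev w @ (s(i := rev w @ s i)) j else (s(i := rev w @ s i)) j)
      = (\<lambda>j. if j \<in> set (i # js) then rev w @ s j else s j)"
    using Cons.prems by auto
  with exec_SEQ[OF exec_put[of i w s] Cons.IH[of "s(i := rev w @ s i)"]] Cons.prems
  show ?case by (simp add: add_ac)
qed

lemma exec_transduce:
  assumes "s i = w @ r" "Some ` set w \<subseteq> A" "top_symbol r \<notin> A"
    and "distinct js" "i \<notin> set js" "\<And>a. a \<in> set w \<Longrightarrow> length (g a) \<le> m"
    and "s' = (\<lambda>j. if j = i then r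
      else if j \<in> set js then rev (concat (map g w)) @ s j else s j)"
    and "Suc ((6 + length js * Suc m) * length w) \<le> n"
  shows "exec (transduce i A g js) s n s'"
  using assms
proof (induction w arbitrary: s n)
  case Nil
  have "s' = s" using Nil by auto
  moreover have "exec (transduce i A g js) s (Suc 0) s"
    unfolding transduce_def by (rule exec_each_stop) (use Nil in auto)
  ultimately show ?case using Nil(8) by (auto elim!: exec_mono)
next
  case (Cons a w)
  let ?s1 = "\<lambda>j. if j \<in> set js then rev (g a) @ (s(i := w @ r)) j else (s(i := w @ r)) j"
  let ?m = "Suc (length js * Suc m)"
  have 1: "exec (block (map (\<lambda>j. put j (g a)) js)) (s(i := w @ r)) ?m ?s1"
    by (rule exec_mono[OF exec_puts]) (use Cons.prems(4,6) in auto)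
  have 2: "exec (transduce i A g js) ?s1 (Suc ((6 + length js * Suc m) * length w)) s'"
    by (rule Cons.IH) (use Cons.prems in \<open>auto simp: fun_eq_iff\<close>)
  have "exec (each i A (\<lambda>a. block (map (\<lambda>j. put j (g a)) js))) s
     (?m + Suc ((6 + length js * Suc m) * length w) + 5) s'"
    by (rule exec_each_step[OF _ _ 1 2[unfolded transduce_def]]) (use Cons.prems in auto)
  then show ?case unfolding transduce_def
    by (rule exec_mono) (use Cons.prems(8) in \<open>auto simp: algebra_simps\<close>)
qed

abbreviation shift :: "nat \<Rightarrow> symbol option set \<Rightarrow> nat list \<Rightarrow> com" where
  "shift i A js \<equiv> transduce i A (\<lambda>a. [a]) js"

lemma input_store_nth [simp]:
  "input_store (x # xs) 0 = x"
  "input_store (x # xs) (Suc i) = input_store xs i"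
  "input_store (x # xs) (numeral v) = input_store xs (pred_numeral v)"
  "input_store [] i = []"
  by (simp_all add: input_store_def numeral_eq_Suc)

lemma list_update_numeral [simp]:
  "(x # xs)[numeral v := y] = x # xs[pred_numeral v := y]"
  by (simp add: numeral_eq_Suc)

lemma input_store_upd [simp]:
  "i < length ws \<Longrightarrow> (input_store ws)(i := w) = input_store (ws[i := w])"
  by (auto simp: input_store_def fun_eq_iff nth_list_update)

abbreviation "st \<equiv> input_store"

lemma exec_shift_st:
  assumes "st ws i = w @ r" "Some ` set w \<subseteq> A" "top_symbol r \<notin> A"
    and "distinct js" "i \<notin> set js" "i < length ws" "\<forall>j\<in>set js. j < length ws"
  shows "exec (shift i A js) (st ws) (Suc ((6 + length js * 2) * length w))
    (st (fold (\<lambda>j xs. xs[j := rev w @ ws ! j]) js (ws[i := r])))"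
proof -
  let ?f = "\<lambda>j xs. xs[j := rev w @ ws ! j]"
  have len: "length (fold ?f js xs) = length xs" for xs js
    by (induction js arbitrary: xs) auto
  have nth: "fold ?f js xs ! j = (if j \<in> set js then rev w @ ws ! j else xs ! j)"
    if "j < length xs" for xs j js
    using that by (induction js arbitrary: xs) (auto simp: nth_list_update)
  show ?thesis
    by (rule exec_transduce[where m = 1 and w = w and r = r])
      (use assms in \<open>auto simp: input_store_def fun_eq_iff len nth nth_list_update\<close>)
qed


lemma input_store_nth_ws: "i < length ws \<Longrightarrow> input_store ws i = ws ! i"
  by (simp add: input_store_def)

text \<open>This rule and the next four execute a block symbolically: the equation for
  \<open>ws'\<close> has simp normalise the store before the next instruction, and the step counts
  add up in a schematic bound that is compared with the claimed one at the end.\<close>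

lemma block_done: "ws = ws' \<Longrightarrow> exec (block []) (st ws) (Suc 0) (st ws')"
  by (simp add: exec_SKIP)

lemma block_put:
  assumes "i < length ws" "ws[i := rev w @ ws ! i] = ws'" "exec (block cs) (st ws') n s'"
  shows "exec (block (put i w # cs)) (st ws) (Suc (length w) + n) s'"
  using exec_block_Cons[OF exec_put[of i w "st ws"]] assms by (simp add: input_store_nth_ws)

lemma block_PUSH:
  assumes "i < length ws" "ws[i := a # ws ! i] = ws'" "exec (block cs) (st ws') n s'"
  shows "exec (block (PUSH i a # cs)) (st ws) (Suc 0 + n) s'"
  using exec_block_Cons[OF exec_PUSH[of i a "st ws"]] assms by (simp add: input_store_nth_ws)

lemma block_POP:
  assumes "i < length ws" "ws[i := tl (ws ! i)] = ws'" "exec (block cs) (st ws') n s'"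
  shows "exec (block (POP i # cs)) (st ws) (Suc 0 + n) s'"
  using exec_block_Cons[OF exec_POP[of i "st ws"]] assms by (simp add: input_store_nth_ws)

lemma block_shift:
  assumes "ws ! i = w @ r" "Some ` set w \<subseteq> A" "top_symbol r \<notin> A"
    and "distinct js \<and> i \<notin> set js \<and> i < length ws \<and> (\<forall>j\<in>set js. j < length ws)"
    and "fold (\<lambda>j xs. xs[j := rev w @ ws ! j]) js (ws[i := r]) = ws'"
    and "exec (block cs) (st ws') n s'"
  shows "exec (block (shift i A js # cs)) (st ws) (Suc ((6 + length js * 2) * length w) + n) s'"
  using exec_block_Cons[OF exec_shift_st[of ws i w r A js]] assms
  by (simp add: input_store_nth_ws)

section \<open>Binary numbers and prefix codes\<close>

lemma bin_0 [simp]: "bin 0 = []"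
  by (simp add: bin.simps)

lemma bin_double_Suc: "bin (Suc (2 * n)) = One # bin n"
  by (subst bin.simps) simp

lemma bin_double: "n > 0 \<Longrightarrow> bin (2 * n) = Zero # bin n"
  by (subst bin.simps) simp

lemma bin_1: "bin (Suc 0) = [One]"
  using bin_double_Suc[of 0] by simp

lemma bin_power: "bin (2 ^ j) = replicate j Zero @ [One]"
  by (induction j) (simp_all add: bin_1 bin_double)

lemma set_bin: "set (bin n) \<subseteq> {Zero, One}"
  by (induction n rule: bin.induct) (subst bin.simps, auto)

lemma bin_inj: "bin m = bin n \<Longrightarrow> m = n"
proof (induction m arbitrary: n rule: bin.induct)
  case (1 m)
  show ?case
  proof (cases "m = 0 \<or> n = 0")
    case True
    then show ?thesis using 1(2) by (subst (asm) (1 2) bin.simps) (auto split: if_splits)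
  next
    case False
    then have "odd m \<longleftrightarrow> odd n" "bin (m div 2) = bin (n div 2)"
      using 1(2) by (subst (asm) (2 1) bin.simps, auto split: if_splits)+
    then have "odd m \<longleftrightarrow> odd n" "m div 2 = n div 2" using 1(1) False by auto
    then show ?thesis by (metis bit_eq_rec)
  qed
qed

lemma bin_eq_iff: "bin m = bin n \<longleftrightarrow> m = n"
  using bin_inj by blast

text \<open>The arbitrary remainders express that a parser knows where the first codeword ends. This
  carries over to pairs and, with \<open>starts_open\<close>, to lists, which injectivity alone does
  not.\<close>

definition prefix_code :: "('a \<Rightarrow> word) \<Rightarrow> bool" where
  "prefix_code f \<longleftrightarrow> (\<forall>x y r r'. f x @ r = f y @ r' \<longrightarrow> x = y \<and> r = r')"

text \<open>Tells the beginning of a list element from the \<open>Close\<close> that ends the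
  list.\<close>

definition starts_open :: "('a \<Rightarrow> word) \<Rightarrow> bool" where
  "starts_open f \<longleftrightarrow> (\<forall>x. \<exists>w. f x = Open # w)"

lemma prefix_codeD: "prefix_code f \<Longrightarrow> f x @ r = f y @ r' \<Longrightarrow> x = y \<and> r = r'"
  unfolding prefix_code_def by blast

lemma prefix_code_inj: "prefix_code f \<Longrightarrow> f x = f y \<Longrightarrow> x = y"
  using prefix_codeD[of f x "[]" y "[]"] by simp

lemma starts_open_enc_nat: "starts_open enc_nat"
  by (simp add: starts_open_def enc_nat_def)

lemma starts_open_enc_list: "starts_open (enc_list f)"
  by (simp add: starts_open_def enc_list_def)

lemma starts_open_enc_pair: "starts_open f \<Longrightarrow> starts_open (enc_pair f g)"
  unfolding starts_open_def enc_pair_def by (metis append_Cons case_prod_unfold)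

text \<open>\<open>bin\<close> never uses \<open>Close\<close>, so the first \<open>Close\<close>
  ends the number.\<close>

lemma prefix_code_enc_nat: "prefix_code enc_nat"
proof -
  have *: "u = v \<and> r = r'" if "u @ Close # r = v @ Close # r'" "Close \<notin> set u" "Close \<notin> set v"
    for u v r r'
    using that
  proof (induction u arbitrary: v)
    case Nil
    then show ?case by (cases v) auto
  next
    case (Cons a u)
    then show ?case by (cases v) auto
  qed
  show ?thesis
    unfolding prefix_code_def
  proof (intro allI impI)
    fix x y r r' assume "enc_nat x @ r = enc_nat y @ r'"
    then have "bin x @ Close # r = bin y @ Close # r'" by (simp add: enc_nat_def)
    from *[OF this] show "x = y \<and> r = r'"
      using set_bin[of x] set_bin[of y] bin_inj[of x y] by auto
  qed
qed

lemma prefix_code_enc_pair: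
  assumes "prefix_code f" "prefix_code g"
  shows "prefix_code (enc_pair f g)"
  unfolding prefix_code_def
proof (intro allI impI)
  fix x y :: "'a \<times> 'b" and r r' :: word
  assume "enc_pair f g x @ r = enc_pair f g y @ r'"
  then have "f (fst x) @ g (snd x) @ r = f (fst y) @ g (snd y) @ r'"
    by (simp add: enc_pair_def case_prod_unfold)
  from prefix_codeD[OF assms(1) this] prefix_codeD[OF assms(2)] show "x = y \<and> r = r'"
    by (metis prod_eqI)
qed

lemma prefix_code_enc_list:
  assumes "prefix_code f" "starts_open f"
  shows "prefix_code (enc_list f)"
proof -
  have "xs = ys \<and> r = r'"
    if "concat (map f xs) @ Close # r = concat (map f ys) @ Close # r'" for xs ys r r'
    using that
  proof (induction xs arbitrary: ys)
    case Nil
    then show ?case using assms(2) by (cases ys) (auto simp: starts_open_def, metis append_Cons list.inject symbol.distinct(11))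
  next
    case (Cons x xs)
    show ?case
    proof (cases ys)
      case Nil
      obtain w where "f x = Open # w" using assms(2) by (auto simp: starts_open_def)
      then show ?thesis using Cons.prems Nil by simp
    next
      case (Cons y ys')
      with Cons.prems have "f x @ concat (map f xs) @ Close # r = f y @ concat (map f ys') @ Close # r'"
        by simp
      from prefix_codeD[OF assms(1) this] Cons.IH[of ys'] show ?thesis
        by (simp add: Cons)
    qed
  qed
  then show ?thesis unfolding prefix_code_def enc_list_def by simp
qed

lemmas prefix_code_intros =
  prefix_code_enc_nat prefix_code_enc_pair prefix_code_enc_list
  starts_open_enc_nat starts_open_enc_pair starts_open_enc_list

abbreviation enc_graph :: "nat list \<times> (nat \<times> nat) list \<Rightarrow> word" where
  "enc_graph \<equiv> enc_pair (enc_list enc_nat) (enc_list (enc_pair enc_nat enc_nat))"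

abbreviation enc_temporal_graph :: "nat \<times> nat list \<times> nat tedge list \<Rightarrow> word" where
  "enc_temporal_graph \<equiv> enc_pair enc_nat (enc_pair (enc_list enc_nat) (enc_list enc_tedge))"

text \<open>Yes-instances ask for some graph encoded by the word; uniqueness turns this into a
  statement about the graph at hand.\<close>

lemma encodes_graph_unique:
  assumes "encodes_graph w V E" "encodes_graph w V' E'"
  shows "V = V' \<and> E = E'"
proof -
  obtain vs es where 1: "w = enc_graph (vs, es)" "set vs = V" "set (map (\<lambda>(u, v). {u, v}) es) = E"
    using assms(1) unfolding encodes_graph_def by blast
  obtain vs' es' where 2: "w = enc_graph (vs', es')" "set vs' = V'" "set (map (\<lambda>(u, v). {u, v}) es') = E'"
    using assms(2) unfolding encodes_graph_def by blast
  have "prefix_code enc_graph" by (intro prefix_code_intros)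
  from prefix_code_inj[OF this 1(1)[symmetric, unfolded 2(1)]] show ?thesis
    using 1(2,3) 2(2,3) by simp
qed

lemma encodes_temporal_graph_unique:
  assumes "encodes_temporal_graph w V E T" "encodes_temporal_graph w V' E' T'"
  shows "V = V' \<and> E = E' \<and> T = T'"
proof -
  obtain vs es where 1: "w = enc_temporal_graph (T, vs, es)" "set vs = V" "set es = E"
    using assms(1) unfolding encodes_temporal_graph_def by blast
  obtain vs' es' where 2: "w = enc_temporal_graph (T', vs', es')" "set vs' = V'" "set es' = E'"
    using assms(2) unfolding encodes_temporal_graph_def by blast
  have "prefix_code enc_temporal_graph"
    unfolding enc_tedge_def by (intro prefix_code_intros)
  from prefix_code_inj[OF this 1(1)[symmetric, unfolded 2(1)]] show ?thesis
    using 1(2,3) 2(2,3) by simp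
qed

section \<open>The program\<close>

definition bits where "bits = {Some Zero, Some One}"

text \<open>
  Stack 0 holds the input and later the output, which is written from its end; stack 1 keeps the
  parameter; 2 and 4 hold the vertex list, reversed and in order; 3 holds the reversed list of
  groups; 5 holds the name of the vertex whose edge is being written. Stacks 6, 7 and 9 keep what
  has been popped from 5, 3 and 8, and stack 8 counts in unary the groups passed so far.
\<close>

text \<open>
  After a mismatch, \<^const>\<open>Open\<close> markers on stack 5 block every later match, so that stack 5 ends
  up empty iff the two names are equal.
\<close>

definition compare where
  "compare = each 3 bits (\<lambda>a. block [PUSH 7 a, IF 5 {Some a} (block [POP 5, PUSH 6 a]) (PUSH 5 Open)])"

text \<open>Since output is written from its end, the word of \<open>2 ^ Suc j\<close> precedes that
  of \<open>2 ^ j\<close> in time; it has one \<open>Zero\<close> more. The other zeros are copied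
  from the unary counter on stack 8, which moves to stack 9 and back.\<close>

definition emit where
  "emit = block [put 0 [Close, One, Zero], shift 8 (range Some) [0, 9],
     put 0 [Open, Close, One], shift 9 (range Some) [0, 8], put 0 [Open]]"

text \<open>The last two moves undo the comparison: markers are erased and the matched symbols
  return to stack 5.\<close>

definition item where
  "item = block [POP 3, PUSH 7 Close, compare, POP 3, PUSH 7 Open, IF 5 {None} emit SKIP,
     shift 5 {Some Open} [], shift 6 (range Some) [5]]"

text \<open>\<open>item\<close> consumes a name from its \<open>Close\<close> to its
  \<open>Open\<close>, so a \<open>Zero\<close> met by this loop is never a bit of a name but the
  mark that starts a group.\<close>

definition scan where
  "scan = WHILE 3 (range Some)
     (IF 3 {Some Close} item (block [POP 3, PUSH 7 Zero, PUSH 8 Zero]))"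

text \<open>The final \<open>put\<close> reads \<open>Open, Close, Open, One\<close> from the top:
  the centre 0, then the start of a name whose low bit 1 turns \<open>bin u\<close> into the word of
  \<open>2 * u + 1\<close>. The name also returns to stack 2 for the vertex list written
  later.\<close>

definition vertex where
  "vertex = block [POP 4, PUSH 2 Open, shift 4 bits [2, 5], POP 4, PUSH 2 Close,
     PUSH 0 Close, scan, shift 7 (range Some) [3], shift 8 (range Some) [],
     put 0 [Open, Close], shift 5 (range Some) [0], put 0 [One, Open, Close, Open]]"

text \<open>\<open>Zero\<close> is pushed last and lies on top of its group, so a scan counts a
  group before reading its names.\<close>

definition load_vertex where
  "load_vertex = block [shift 0 (insert (Some Open) bits) [2, 3], POP 0, PUSH 2 Close,
     put 3 [Close, Zero]]"

definition load_edge where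
  "load_edge = block [shift 0 (insert (Some Open) bits) [3], POP 0, PUSH 3 Close,
     shift 0 (insert (Some Open) bits) [3], POP 0, put 3 [Close, Zero]]"

text \<open>Once both lists are loaded the input is consumed and stack 0 is free for output. The
  pass over stack 2 meets names backwards, so the \<open>One\<close> pushed just before
  \<open>Open\<close> becomes their low bit. The pass over stack 3 puts zeros in front of a
  \<open>One\<close>, which yields the lifetime.\<close>

definition reduce where
  "reduce = block [POP 0, WHILE 0 {Some Open} load_vertex, POP 0, POP 0,
     WHILE 0 {Some Open} load_edge, POP 0, shift 2 (range Some) [4],
     PUSH 0 Close, WHILE 4 {Some Open} vertex, put 0 [Open, Close],
     transduce 2 (range Some) (\<lambda>a. if a = Open then [One, Open] else [a]) [0],
     put 0 [Close, Open, Open, Close, One],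
     transduce 3 (range Some) (\<lambda>a. [Zero]) [0], PUSH 0 Open]"

section \<open>Correctness and step bounds of the program\<close>

lemma exec_emit:
  "exec emit (st [o', k, p, e, v, x, x', e', replicate j Zero, []]) (20 * j + 20)
     (st [Open # replicate j Zero @ [One, Close] @ Open # Zero # replicate j Zero @ [One, Close] @ o',
       k, p, e, v, x, x', e', replicate j Zero, []])"
  unfolding emit_def
  apply (rule exec_mono)
   apply (rule block_put, simp, simp)
   apply (rule block_shift[where w = "replicate j Zero" and r = "[]"],
     simp, simp add: image_subset_iff, simp, simp, simp)
   apply (rule block_put, simp, simp)
   apply (rule block_shift[where w = "replicate j Zero" and r = "[]"],
     simp, simp add: image_subset_iff, simp, simp, simp)
   apply (rule block_put, simp, simp)
   apply (rule block_done)
   apply (simp add: replicate_append_same)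
  apply simp
  done

text \<open>The induction needs arbitrary numbers \<open>n\<close> and \<open>m\<close> of markers
  before and after. \<open>z\<close> is the part of \<open>y\<close> that was matched and moved to
  stack 6, \<open>y'\<close> the rest. As \<open>w\<close> consists of bits, none of its symbols
  matches a marker.\<close>

lemma exec_compare:
  assumes "set w \<subseteq> {Zero, One}" "set y \<subseteq> {Zero, One}" "top_symbol r \<notin> bits"
  shows "\<exists>m z y'. m \<le> n + length w \<and> y = z @ y' \<and> (m = 0 \<and> y' = [] \<longleftrightarrow> n = 0 \<and> w = y) \<and>
    exec compare (st [out, k, p, w @ r, v, replicate n Open @ y, x, e, j, q]) (Suc (14 * length w))
      (st [out, k, p, r, v, replicate m Open @ y', rev z @ x, rev w @ e, j, q])"
  using assms(1,2)
proof (induction w arbitrary: n y x e)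
  case Nil
  show ?case
    by (intro exI[of _ n] exI[of _ "[]"] exI[of _ y] conjI)
      (use exec_each_stop assms(3) in \<open>auto simp: compare_def\<close>)
next
  case (Cons a w)
  define f where "f = (\<lambda>a. block [PUSH 7 a, IF 5 {Some a} (block [POP 5, PUSH 6 a]) (PUSH 5 Open)])"
  have compare: "compare = each 3 bits f" by (simp add: compare_def f_def)
  \<comment> \<open>A match requires that no marker is present, so \<open>n\<close> is 0 and stays
    0; in every other case one marker is added.\<close>
  define good where "good \<longleftrightarrow> n = 0 \<and> y \<noteq> [] \<and> hd y = a"
  define n1 where "n1 = (if good then 0 else Suc n)"
  define y1 where "y1 = (if good then tl y else y)"
  define x1 where "x1 = (if good then a # x else x)"
  have "set y1 \<subseteq> {Zero, One}" using Cons.prems by (cases y) (auto simp: y1_def)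
  with Cons.IH[of y1 n1 x1 "a # e"] Cons.prems obtain m z y' where
    m: "m \<le> n1 + length w" and y': "y1 = z @ y'" "m = 0 \<and> y' = [] \<longleftrightarrow> n1 = 0 \<and> w = y1" and
    ex: "exec compare (st [out, k, p, w @ r, v, replicate n1 Open @ y1, x1, a # e, j, q])
      (Suc (14 * length w))
      (st [out, k, p, r, v, replicate m Open @ y', rev z @ x1, rev w @ a # e, j, q])"
    by auto
  have a: "a \<noteq> Open" "Some a \<in> bits" using Cons.prems by (auto simp: bits_def)
  have step: "exec (f a) (st [out, k, p, w @ r, v, replicate n Open @ y, x, e, j, q]) 7
      (st [out, k, p, w @ r, v, replicate n1 Open @ y1, x1, a # e, j, q])"
  proof (cases good)
    case True
    then obtain y2 where y2: "y = a # y2" "n = 0" by (cases y) (auto simp: good_def)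
    show ?thesis unfolding f_def
      apply (rule exec_mono)
       apply (rule block_PUSH, simp, simp)
       apply (rule exec_block_Cons[OF exec_IF_True exec_SKIP[unfolded block.simps(1)[symmetric]]])
        apply (simp add: y2)
       apply (rule block_POP, simp, simp)
       apply (rule block_PUSH, simp, simp)
       apply (rule block_done)
       apply (simp add: y2 n1_def y1_def x1_def True)
      apply simp
      done
  next
    case False
    then have top: "top_symbol (replicate n Open @ y) \<noteq> Some a"
      using a by (cases n; cases y) (auto simp: good_def)
    have *: "exec (PUSH 5 Open) (st [out, k, p, w @ r, v, replicate n Open @ y, x, a # e, j, q])
      (Suc 0) (st [out, k, p, w @ r, v, replicate n1 Open @ y1, x1, a # e, j, q])"
      using exec_PUSH[of 5 Open "st [out, k, p, w @ r, v, replicate n Open @ y, x, a # e, j, q]"]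
      by (simp add: False n1_def y1_def x1_def)
    show ?thesis unfolding f_def
      apply (rule exec_mono)
       apply (rule block_PUSH, simp, simp)
       apply (rule exec_block_Cons[OF exec_IF_False exec_SKIP[unfolded block.simps(1)[symmetric]]])
        apply (use top in simp)
       apply (rule *)
      apply simp
      done
  qed
  have "exec compare (st [out, k, p, (a # w) @ r, v, replicate n Open @ y, x, e, j, q])
     (7 + Suc (14 * length w) + 5)
     (st [out, k, p, r, v, replicate m Open @ y', rev z @ x1, rev w @ a # e, j, q])"
    unfolding compare
    by (rule exec_each_step[where a = a and w = "w @ r"])
      (use a step ex in \<open>simp_all add: compare\<close>)
  then have ex': "exec compare (st [out, k, p, (a # w) @ r, v, replicate n Open @ y, x, e, j, q])
     (Suc (14 * length (a # w)))
     (st [out, k, p, r, v, replicate m Open @ y', rev z @ x1, rev (a # w) @ e, j, q])"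
    by (auto elim!: exec_mono)
  show ?case
  proof (cases good)
    case True
    then have y: "y = a # y1" by (cases y) (auto simp: y1_def good_def)
    show ?thesis
      by (intro exI[of _ m] exI[of _ "a # z"] exI[of _ y'] conjI)
        (use True m y' y ex' in \<open>auto simp: n1_def x1_def good_def\<close>)
  next
    case False
    have "\<not> (n = 0 \<and> a # w = y)" using False by (auto simp: good_def)
    then show ?thesis
      by (intro exI[of _ m] exI[of _ z] exI[of _ y'] conjI)
        (use False m y' ex' in \<open>auto simp: n1_def x1_def y1_def\<close>)
  qed
qed

definition interval_word :: "nat \<Rightarrow> word" where
  "interval_word j = enc_pair enc_nat enc_nat (2 ^ j, 2 ^ Suc j)"

lemma interval_word_eq:
  "interval_word j = Open # replicate j Zero @ [One, Close] @ Open # Zero # replicate j Zero @ [One, Close]"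
  using bin_power[of "Suc j"] by (simp add: interval_word_def enc_pair_def enc_nat_def bin_power)

lemma exec_item:
  assumes w: "set w \<subseteq> {Zero, One}" and y: "set y \<subseteq> {Zero, One}"
  shows "exec item (st [out, k, p, Close # w @ Open # r, v, y, [], e, replicate j Zero, []])
     (20 * length w + 20 * j + 8 * length y + 40)
     (st [if w = y then interval_word j @ out else out, k, p, r, v, y, [], Open # rev w @ Close # e,
       replicate j Zero, []])"
proof -
  obtain m z y' where m: "m \<le> length w" and y': "y = z @ y'" "m = 0 \<and> y' = [] \<longleftrightarrow> w = y" and
    ex: "exec compare (st [out, k, p, w @ Open # r, v, y, [], Close # e, replicate j Zero, []])
      (Suc (14 * length w))
      (st [out, k, p, Open # r, v, replicate m Open @ y', rev z, rev w @ Close # e, replicate j Zero, []])"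
    using exec_compare[OF w y, of "Open # r" 0 out k p v "[]" "Close # e" "replicate j Zero" "[]"]
    by (auto simp: bits_def)
  have top: "top_symbol (replicate m Open @ y') = None \<longleftrightarrow> w = y"
    using y'(2) by (cases m; cases y') auto
  have "exec (IF 5 {None} emit SKIP) (st [out, k, p, r, v, replicate m Open @ y', rev z,
        Open # rev w @ Close # e, replicate j Zero, []]) (20 * j + 21)
     (st [if w = y then interval_word j @ out else out, k, p, r, v, replicate m Open @ y', rev z,
        Open # rev w @ Close # e, replicate j Zero, []])"
  proof (cases "w = y")
    case True
    have *: "exec emit (st [out, k, p, r, v, replicate m Open @ y', rev z,
        Open # rev w @ Close # e, replicate j Zero, []]) (20 * j + 20)
     (st [if w = y then interval_word j @ out else out, k, p, r, v, replicate m Open @ y', rev z,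
        Open # rev w @ Close # e, replicate j Zero, []])"
      using exec_emit[of out k p r v "replicate m Open @ y'" "rev z" "Open # rev w @ Close # e" j] True
      by (simp add: interval_word_eq)
    show ?thesis
      by (rule exec_mono[OF exec_IF_True[OF _ *]]) (use top True in simp_all)
  next
    case False
    show ?thesis
      unfolding if_not_P[OF False] by (rule exec_mono[OF exec_IF_False[OF _ exec_SKIP]]) (use top False in simp_all)
  qed
  note if_ex = this
  \<comment> \<open>What is left of the name consists of bits, so erasing the markers stops exactly
    before it.\<close>
  have top': "top_symbol y' \<noteq> Some Open" using y y' by (cases y') auto
  show ?thesis unfolding item_def
    apply (rule exec_mono)
     apply (rule block_POP, simp, simp)
     apply (rule block_PUSH, simp, simp)
     apply (rule exec_block_Cons, rule ex)
     apply (rule block_POP, simp, simp)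
     apply (rule block_PUSH, simp, simp)
     apply (rule exec_block_Cons, rule if_ex)
     apply (rule block_shift[where w = "replicate m Open" and r = y'],
       simp, simp add: image_subset_iff, simp add: top', simp, simp)
     apply (rule block_shift[where w = "rev z" and r = "[]"],
       simp, simp add: image_subset_iff, simp, simp, simp)
     apply (rule block_done)
     apply (simp add: y')
    apply (use m in \<open>simp add: y' del: replicate.simps\<close>)
    done
qed

text \<open>\<open>None\<close> marks the start of a group, whose vertices then follow.\<close>

definition enc_token :: "nat option \<Rightarrow> word" where
  "enc_token t = (case t of None \<Rightarrow> [Zero] | Some u \<Rightarrow> Close # rev (bin u) @ [Open])"

definition enc_tokens :: "nat option list \<Rightarrow> word" where
  "enc_tokens ts = concat (map enc_token ts)"

lemma enc_tokens_simps [simp]: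
  "enc_tokens [] = []"
  "enc_tokens (None # ts) = Zero # enc_tokens ts"
  "enc_tokens (Some u # ts) = Close # rev (bin u) @ Open # enc_tokens ts"
  "enc_tokens (ts @ ts') = enc_tokens ts @ enc_tokens ts'"
  by (simp_all add: enc_tokens_def enc_token_def)

text \<open>Mirrors the scan: \<open>j\<close> is the counter on stack 8, so the result lists the
  exponents of the intervals emitted for \<open>u\<close>.\<close>

fun occurrences :: "nat \<Rightarrow> nat \<Rightarrow> nat option list \<Rightarrow> nat list" where
  "occurrences u j [] = []"
| "occurrences u j (None # ts) = occurrences u (Suc j) ts"
| "occurrences u j (Some v # ts) = (if v = u then [j] else []) @ occurrences u j ts"

definition separators :: "nat option list \<Rightarrow> nat" where
  "separators ts = length (filter (\<lambda>t. t = None) ts)"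

text \<open>A separator uses up one symbol and adds one to the counter, so
  \<open>length (enc_tokens ts) + j\<close> never grows. One \<open>N\<close> thus bounds names,
  remaining list and counter, and a token costs at most \<open>100 * Suc N\<close> steps.\<close>

lemma exec_scan:
  assumes "length (bin u) \<le> N" "length (enc_tokens ts) + j \<le> N"
  shows "exec scan (st [out, k, p, enc_tokens ts, v, rev (bin u), [], e, replicate j Zero, []])
     (Suc (length ts * (100 * Suc N)))
     (st [concat (map interval_word (rev (occurrences u j ts))) @ out, k, p, [], v, rev (bin u), [],
       rev (enc_tokens ts) @ e, replicate (j + separators ts) Zero, []])"
  using assms(2)
proof (induction ts arbitrary: j out e)
  case Nil
  show ?case
    by (simp add: scan_def separators_def exec_WHILE_stop)
next
  case (Cons t ts)
  show ?case
  proof (cases t)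
    case None
    show ?thesis unfolding scan_def None
      apply (rule exec_mono)
       apply (rule exec_WHILE_step)
         apply simp
        apply (rule exec_IF_False)
         apply simp
        apply (rule block_POP, simp, simp)
        apply (rule block_PUSH, simp, simp)
        apply (rule block_PUSH, simp, simp)
        apply (rule block_done, rule refl)
       apply (fold scan_def)
       apply (use Cons.IH[of "Suc j" out "Zero # e"] Cons.prems in \<open>simp add: None separators_def\<close>)
      apply simp
      done
  next
    case (Some a)
    have ba: "length (bin a) \<le> N" using Cons.prems Some by simp
    have "exec item (st [out, k, p, enc_tokens (t # ts), v, rev (bin u), [], e, replicate j Zero, []])
       (20 * length (rev (bin a)) + 20 * j + 8 * length (rev (bin u)) + 40)
       (st [if a = u then interval_word j @ out else out, k, p, enc_tokens ts, v, rev (bin u), [],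
          Open # bin a @ Close # e, replicate j Zero, []])"
      \<comment> \<open>The program compares words; \<open>bin_eq_iff\<close> makes this equality of
        numbers.\<close>
      using exec_item[of "rev (bin a)" "rev (bin u)" out k p "enc_tokens ts" v e j] set_bin
      by (simp add: Some bin_eq_iff)
    then have item: "exec item (st [out, k, p, enc_tokens (t # ts), v, rev (bin u), [], e, replicate j Zero, []])
       (90 * Suc N)
       (st [if a = u then interval_word j @ out else out, k, p, enc_tokens ts, v, rev (bin u), [],
          Open # bin a @ Close # e, replicate j Zero, []])"
      by (rule exec_mono) (use Cons.prems assms(1) in \<open>simp add: Some\<close>)
    have eqs: "concat (map interval_word (rev (occurrences u j ts))) @
        (if a = u then interval_word j @ out else out) =
        concat (map interval_word (rev (occurrences u j (t # ts)))) @ out"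
      "rev (enc_tokens ts) @ Open # bin a @ Close # e = rev (enc_tokens (t # ts)) @ e"
      "separators (t # ts) = separators ts"
      by (simp_all add: Some separators_def)
    have "length (enc_tokens ts) + j \<le> N" using Cons.prems by (simp add: Some)
    note IH = Cons.IH[OF this, of "if a = u then interval_word j @ out else out" "Open # bin a @ Close # e"]
    have ih: "exec scan (st [if a = u then interval_word j @ out else out, k, p, enc_tokens ts, v,
        rev (bin u), [], Open # bin a @ Close # e, replicate j Zero, []])
      (Suc (length ts * (100 * Suc N)))
      (st [concat (map interval_word (rev (occurrences u j (t # ts)))) @ out, k, p, [], v,
        rev (bin u), [], rev (enc_tokens (t # ts)) @ e, replicate (j + separators (t # ts)) Zero, []])"
      using IH by (simp only: eqs)
    show ?thesis unfolding scan_def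
      apply (rule exec_mono)
       apply (rule exec_WHILE_step)
         apply (simp add: Some)
        apply (rule exec_IF_True)
         apply (simp add: Some)
        apply (rule item)
       apply (fold scan_def)
       apply (rule ih)
      apply simp
      done
  qed
qed

lemma Some_set_bin: "Some ` set (bin u) \<subseteq> bits"
  using set_bin[of u] by (auto simp: bits_def)

lemma Some_set_Open_bin: "Some ` set (Open # bin u) \<subseteq> insert (Some Open) bits"
  using Some_set_bin[of u] by auto

lemma Close_notin_bits [simp]: "Some Close \<notin> bits"
  by (simp add: bits_def)

text \<open>\<open>rev\<close>, because the scan emits rising exponents onto an output that grows at
  its front.\<close>

definition star_edge :: "nat option list \<Rightarrow> nat \<Rightarrow> nat tedge" where
  "star_edge ts u = (0, Suc (2 * u), map (\<lambda>j. (2 ^ j, 2 ^ Suc j)) (rev (occurrences u 0 ts)))"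

lemma enc_star_edge:
  "enc_tedge (star_edge ts u) = Open # Close # Open # One # bin u @ Close # Open #
     concat (map interval_word (rev (occurrences u 0 ts))) @ [Close]"
  by (simp add: enc_tedge_def star_edge_def enc_pair_def enc_list_def interval_word_def[abs_def] o_def
      enc_nat_def bin_double_Suc)

lemma length_le_enc_tokens: "length ts \<le> length (enc_tokens ts)"
  by (induction ts) (auto simp: enc_tokens_def enc_token_def split: option.split)

lemma separators_le: "separators ts \<le> length ts"
  by (simp add: separators_def)

text \<open>The scan meets at most \<open>N\<close> tokens at linear cost each, hence the square;
  the other moves are linear.\<close>

lemma exec_vertex:
  assumes "length (bin u) \<le> N" "length (enc_tokens ts) \<le> N"
  shows "exec vertex (st [out, k, p, enc_tokens ts, enc_nat u @ v, [], [], [], [], []])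
     (200 * (Suc N)\<^sup>2)
     (st [enc_tedge (star_edge ts u) @ out, k, rev (enc_nat u) @ p, enc_tokens ts, v,
       [], [], [], [], []])"
proof -
  have len: "length ts \<le> N" "separators ts \<le> N"
    using length_le_enc_tokens[of ts] separators_le[of ts] assms(2) by simp_all
  have scan: "exec scan (st [Close # out, k, Close # rev (bin u) @ Open # p, enc_tokens ts, v, rev (bin u), [], [], [], []])
     (Suc (length ts * (100 * Suc N)))
     (st [concat (map interval_word (rev (occurrences u 0 ts))) @ Close # out, k, 
       Close # rev (bin u) @ Open # p, [], v, rev (bin u), [],
       rev (enc_tokens ts), replicate (separators ts) Zero, []])"
    using exec_scan[of u N ts 0 "Close # out" k "Close # rev (bin u) @ Open # p" v "[]"] assms
    by simp
  have "length ts * (100 * Suc N) \<le> Suc N * (100 * Suc N)"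
    by (rule mult_right_mono) (use len in auto)
  then have time: "length ts * (100 * Suc N) + 100 * Suc N \<le> 200 * (Suc N)\<^sup>2"
    by (simp add: power2_eq_square algebra_simps)
  show ?thesis unfolding vertex_def
    apply (rule exec_mono)
     apply (rule block_POP, simp, simp)
     apply (rule block_PUSH, simp, simp)
     apply (rule block_shift[where w = "bin u" and r = "Close # v"],
       simp add: enc_nat_def, rule Some_set_bin, simp, simp, simp)
     apply (rule block_POP, simp, simp)
     apply (rule block_PUSH, simp, simp)
     apply (rule block_PUSH, simp, simp)
     apply (rule exec_block_Cons, rule scan)
     apply (rule block_shift[where w = "rev (enc_tokens ts)" and r = "[]"],
       simp, simp add: image_subset_iff, simp add: image_iff, simp, simp)
     apply (rule block_shift[where w = "replicate (separators ts) Zero" and r = "[]"],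
       simp, simp add: image_subset_iff, simp add: image_iff, simp, simp)
     apply (rule block_put, simp, simp)
     apply (rule block_shift[where w = "rev (bin u)" and r = "[]"],
       simp, simp add: image_subset_iff, simp add: image_iff, simp, simp)
     apply (rule block_put, simp, simp)
     apply (rule block_done)
     apply (simp add: enc_star_edge enc_nat_def)
    apply (use time len assms in simp)
    done
qed

lemma exec_vertices:
  assumes "\<forall>u\<in>set vs. length (bin u) \<le> N" "length (enc_tokens ts) \<le> N"
  shows "exec (WHILE 4 {Some Open} vertex)
     (st [out, k, p, enc_tokens ts, concat (map enc_nat vs), [], [], [], [], []])
     (Suc (length vs * Suc (200 * (Suc N)\<^sup>2)))
     (st [concat (map enc_tedge (map (star_edge ts) (rev vs))) @ out, k,
       rev (concat (map enc_nat vs)) @ p, enc_tokens ts, [], [], [], [], [], []])"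
  using assms(1)
proof (induction vs arbitrary: out p)
  case Nil
  show ?case by (simp add: exec_WHILE_stop)
next
  case (Cons u vs)
  then have u: "length (bin u) \<le> N" and vs: "\<forall>u\<in>set vs. length (bin u) \<le> N" by auto
  have "exec (WHILE 4 {Some Open} vertex)
     (st [out, k, p, enc_tokens ts, enc_nat u @ concat (map enc_nat vs), [], [], [], [], []])
     (Suc (200 * (Suc N)\<^sup>2 + Suc (length vs * Suc (200 * (Suc N)\<^sup>2))))
     (st [concat (map enc_tedge (map (star_edge ts) (rev vs))) @ enc_tedge (star_edge ts u) @ out, k,
       rev (concat (map enc_nat vs)) @ rev (enc_nat u) @ p, enc_tokens ts, [], [], [], [], [], []])"
    by (rule exec_WHILE_step[OF _ exec_vertex[OF u assms(2)] Cons.IH[OF vs]])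
      (simp add: enc_nat_def)
  then show ?case by (simp add: add_ac)
qed

definition tokens :: "nat list list \<Rightarrow> nat option list" where
  "tokens gs = concat (map (\<lambda>g. None # map Some g) gs)"

lemma tokens_append [simp]: "tokens (gs @ hs) = tokens gs @ tokens hs"
  by (simp add: tokens_def)

lemma exec_load_vertex:
  assumes "length (bin u) \<le> N"
  shows "exec load_vertex (st [enc_nat u @ r, k, p, e, [], [], [], [], [], []]) (50 * Suc N)
     (st [r, k, rev (enc_nat u) @ p, enc_tokens (tokens [[u]]) @ e, [], [], [], [], [], []])"
  unfolding load_vertex_def
  apply (rule exec_mono)
   apply (rule block_shift[where w = "Open # bin u" and r = "Close # r"],
      simp add: enc_nat_def, rule Some_set_Open_bin, simp, simp, simp)
   apply (rule block_POP, simp, simp)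
   apply (rule block_PUSH, simp, simp)
   apply (rule block_put, simp, simp)
   apply (rule block_done)
   apply (simp add: tokens_def enc_nat_def)
  apply (use assms in simp)
  done

lemma exec_load_edge:
  assumes "length (bin u) \<le> N" "length (bin v) \<le> N"
  shows "exec load_edge (st [enc_nat u @ enc_nat v @ r, k, p, e, [], [], [], [], [], []]) (50 * Suc N)
     (st [r, k, p, enc_tokens (tokens [[v, u]]) @ e, [], [], [], [], [], []])"
  unfolding load_edge_def
  apply (rule exec_mono)
   apply (rule block_shift[where w = "Open # bin u" and r = "Close # enc_nat v @ r"],
      simp add: enc_nat_def, rule Some_set_Open_bin, simp, simp, simp)
   apply (rule block_POP, simp, simp)
   apply (rule block_PUSH, simp, simp)
   apply (rule block_shift[where w = "Open # bin v" and r = "Close # r"],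
      simp add: enc_nat_def, rule Some_set_Open_bin, simp, simp, simp)
   apply (rule block_POP, simp, simp)
   apply (rule block_put, simp, simp)
   apply (rule block_done)
   apply (simp add: tokens_def enc_nat_def)
  apply (use assms in simp)
  done

lemma exec_load_vertices:
  assumes "\<forall>u\<in>set vs. length (bin u) \<le> N"
  shows "exec (WHILE 0 {Some Open} load_vertex)
     (st [concat (map enc_nat vs) @ Close # r, k, p, e, [], [], [], [], [], []])
     (Suc (length vs * Suc (50 * Suc N)))
     (st [Close # r, k, rev (concat (map enc_nat vs)) @ p,
       enc_tokens (tokens (map (\<lambda>v. [v]) (rev vs))) @ e, [], [], [], [], [], []])"
  using assms
proof (induction vs arbitrary: p e)
  case Nil
  show ?case by (simp add: exec_WHILE_stop tokens_def)
next
  case (Cons u vs)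
  then have u: "length (bin u) \<le> N" and vs: "\<forall>u\<in>set vs. length (bin u) \<le> N" by auto
  have "exec (WHILE 0 {Some Open} load_vertex)
     (st [enc_nat u @ concat (map enc_nat vs) @ Close # r, k, p, e, [], [], [], [], [], []])
     (Suc (50 * Suc N + Suc (length vs * Suc (50 * Suc N))))
     (st [Close # r, k, rev (concat (map enc_nat vs)) @ rev (enc_nat u) @ p,
       enc_tokens (tokens (map (\<lambda>v. [v]) (rev vs))) @ enc_tokens (tokens [[u]]) @ e,
       [], [], [], [], [], []])"
    by (rule exec_WHILE_step[OF _ exec_load_vertex[OF u] Cons.IH[OF vs]])
      (simp add: enc_nat_def)
  then show ?case by (simp add: add_ac)
qed

lemma exec_load_edges:
  assumes "\<forall>(u, v)\<in>set es. length (bin u) \<le> N \<and> length (bin v) \<le> N"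
  shows "exec (WHILE 0 {Some Open} load_edge)
     (st [concat (map (enc_pair enc_nat enc_nat) es) @ Close # r, k, p, e, [], [], [], [], [], []])
     (Suc (length es * Suc (50 * Suc N)))
     (st [Close # r, k, p,
       enc_tokens (tokens (map (\<lambda>(u, v). [v, u]) (rev es))) @ e, [], [], [], [], [], []])"
  using assms
proof (induction es arbitrary: e)
  case Nil
  show ?case by (simp add: exec_WHILE_stop tokens_def)
next
  case (Cons uv es)
  obtain u v where uv: "uv = (u, v)" by fastforce
  with Cons.prems have u: "length (bin u) \<le> N" "length (bin v) \<le> N"
    and es: "\<forall>(u, v)\<in>set es. length (bin u) \<le> N \<and> length (bin v) \<le> N" by auto
  have "exec (WHILE 0 {Some Open} load_edge)
     (st [enc_nat u @ enc_nat v @ concat (map (enc_pair enc_nat enc_nat) es) @ Close # r,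
       k, p, e, [], [], [], [], [], []])
     (Suc (50 * Suc N + Suc (length es * Suc (50 * Suc N))))
     (st [Close # r, k, p,
       enc_tokens (tokens (map (\<lambda>(u, v). [v, u]) (rev es))) @ enc_tokens (tokens [[v, u]]) @ e,
       [], [], [], [], [], []])"
    by (rule exec_WHILE_step[OF _ exec_load_edge[OF u] Cons.IH[OF es]])
      (simp add: enc_nat_def)
  then show ?case by (simp add: uv enc_pair_def add_ac)
qed

text \<open>The order in which stack 3 returns what was loaded: edges first, as they were loaded
  last, with both lists and the two names of each edge reversed.\<close>

definition groups :: "nat list \<Rightarrow> (nat \<times> nat) list \<Rightarrow> nat list list" where
  "groups vs es = map (\<lambda>(u, v). [v, u]) (rev es) @ map (\<lambda>v. [v]) (rev vs)"

lemma exec_odd_names: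
  "exec (transduce 2 (range Some) (\<lambda>a. if a = Open then [One, Open] else [a]) [0])
     (st [out, k, rev (concat (map enc_nat vs)), e, [], [], [], [], [], []])
     (Suc (9 * length (concat (map enc_nat vs))))
     (st [concat (map enc_nat (map (\<lambda>v. Suc (2 * v)) vs)) @ out, k, [], e, [], [], [], [], [], []])"
proof -
  let ?g = "\<lambda>a. if a = Open then [One, Open] else [a]"
  have "rev (concat (map ?g (rev (enc_nat v)))) = enc_nat (Suc (2 * v))" for v
  proof -
    have "map ?g (rev (bin v)) = map (\<lambda>a. [a]) (rev (bin v))"
      using set_bin[of v] by (intro map_cong) auto
    then have "concat (map ?g (rev (bin v))) = rev (bin v)"
      by (simp only: concat_map_singleton map_ident)
    then show ?thesis by (simp add: enc_nat_def bin_double_Suc)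
  qed
  then have *: "rev (concat (map ?g (rev (concat (map enc_nat vs))))) =
      concat (map enc_nat (map (\<lambda>v. Suc (2 * v)) vs))"
    by (induction vs) auto
  show ?thesis
    by (rule exec_transduce[where m = 2 and w = "rev (concat (map enc_nat vs))" and r = "[]"])
      (auto simp: * fun_eq_iff input_store_def nth_Cons split: nat.split)
qed

lemma exec_zeros:
  "exec (transduce 3 (range Some) (\<lambda>a. [Zero]) [0])
     (st [out, k, p, e, [], [], [], [], [], []])
     (Suc (8 * length e))
     (st [replicate (length e) Zero @ out, k, p, [], [], [], [], [], [], []])"
proof -
  have *: "rev (concat (map (\<lambda>a. [Zero]) e)) = replicate (length e) Zero"
    by (induction e) (auto simp: replicate_append_same)
  show ?thesis
    by (rule exec_transduce[where m = 1 and w = e and r = "[]"])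
      (auto simp: * map_replicate_const fun_eq_iff input_store_def nth_Cons split: nat.split)
qed

text \<open>Each group costs one symbol beyond its names; the factor 2 absorbs it, since every name
  has two brackets.\<close>

lemma enc_tokens_groups_le: "length (enc_tokens (tokens (groups vs es))) \<le> 2 * length (enc_graph (vs, es))"
proof -
  have "length (enc_tokens (tokens (map (\<lambda>v. [v]) (rev vs)))) \<le> 2 * length (concat (map enc_nat vs))"
    by (induction vs) (auto simp: tokens_def enc_nat_def)
  moreover have "length (enc_tokens (tokens (map (\<lambda>(u, v). [v, u]) (rev es))))
      \<le> 2 * length (concat (map (enc_pair enc_nat enc_nat) es))"
    by (induction es) (auto simp: tokens_def enc_nat_def enc_pair_def)
  ultimately show ?thesis
    by (simp add: groups_def enc_pair_def enc_list_def)
qed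

lemma length_le_concat: "x \<in> set xs \<Longrightarrow> length (f x) \<le> length (concat (map f xs))"
  by (induction xs) auto

text \<open>At most \<open>M\<close> vertices with a quadratic scan each give the cube; the loading
  loops are quadratic and the other passes linear.\<close>

lemma exec_reduce:
  fixes vs es
  defines "w \<equiv> enc_graph (vs, es)" and "ts \<equiv> tokens (groups vs es)"
  shows "exec reduce (st [w, k, [], [], [], [], [], [], [], []]) (1000 * (Suc (2 * length w)) ^ 3)
    (st [enc_temporal_graph (2 ^ length (enc_tokens ts), 0 # map (\<lambda>v. Suc (2 * v)) vs,
       map (star_edge ts) (rev vs)), k, [], [], [], [], [], [], [], []])"
proof -
  define N M where "N = 2 * length w" and "M = Suc N"
  let ?V = "concat (map enc_nat vs)" and ?E = "concat (map (enc_pair enc_nat enc_nat) es)"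
  have w: "w = Open # ?V @ Close # Open # ?E @ [Close]"
    by (simp add: w_def enc_pair_def enc_list_def)
  have V: "length ?V \<le> N" and E: "length ?E \<le> N" by (simp_all add: N_def w)
  have vs: "\<forall>u\<in>set vs. length (bin u) \<le> N"
    using length_le_concat[of _ vs enc_nat] V by (fastforce simp: enc_nat_def)
  have es: "\<forall>(u, v)\<in>set es. length (bin u) \<le> N \<and> length (bin v) \<le> N"
    using length_le_concat[of _ es "enc_pair enc_nat enc_nat"] E
    by (fastforce simp: enc_nat_def enc_pair_def)
  have ts: "length (enc_tokens ts) \<le> N"
    using enc_tokens_groups_le[of vs es] by (simp add: N_def ts_def w_def)
  have "length vs \<le> length ?V" by (induction vs) (auto simp: enc_nat_def)
  then have lvs: "length vs \<le> M" using V by (simp add: M_def)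
  have "length es \<le> length ?E" by (induction es) (auto simp: enc_nat_def enc_pair_def)
  then have les: "length es \<le> M" using E by (simp add: M_def)
  have ts_eq: "enc_tokens ts = enc_tokens (tokens (map (\<lambda>(u, v). [v, u]) (rev es))) @
      enc_tokens (tokens (map (\<lambda>v. [v]) (rev vs)))"
    by (simp add: ts_def groups_def)
  have load_es: "exec (WHILE 0 {Some Open} load_edge)
     (st [?E @ [Close], k, rev ?V, enc_tokens (tokens (map (\<lambda>v. [v]) (rev vs))),
       [], [], [], [], [], []])
     (Suc (length es * Suc (50 * Suc N)))
     (st [[Close], k, rev ?V, enc_tokens ts, [], [], [], [], [], []])"
    using exec_load_edges[OF es, of "[]" k "rev ?V"] by (simp add: ts_eq)
  have load_vs: "exec (WHILE 0 {Some Open} load_vertex)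
     (st [?V @ Close # Open # ?E @ [Close], k, [], [], [], [], [], [], [], []])
     (Suc (length vs * Suc (50 * Suc N)))
     (st [Close # Open # ?E @ [Close], k, rev ?V,
       enc_tokens (tokens (map (\<lambda>v. [v]) (rev vs))), [], [], [], [], [], []])"
    using exec_load_vertices[OF vs, of "Open # ?E @ [Close]" k "[]" "[]"] by simp
  have M1: "1 \<le> M" by (simp add: M_def)
  have M3: "M \<le> M ^ 3" "1 \<le> M ^ 3" using M1 by (simp_all add: self_le_power)
  have "M * Suc (50 * M) \<le> M * (51 * M)" using M1 by (intro mult_left_mono) auto
  also have "\<dots> = 51 * M ^ 2" by (simp add: power2_eq_square)
  also have "\<dots> \<le> 51 * M ^ 3" using M1 by (intro mult_left_mono power_increasing) auto
  finally have "M * Suc (50 * M) \<le> 51 * M ^ 3" .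
  then have t1: "length vs * Suc (50 * M) \<le> 51 * M ^ 3" "length es * Suc (50 * M) \<le> 51 * M ^ 3"
    using lvs les by (meson le_trans mult_le_mono1)+
  have "length vs * Suc (200 * M\<^sup>2) \<le> M * (201 * M\<^sup>2)"
    using lvs M1 by (intro mult_mono) auto
  then have t2: "length vs * Suc (200 * M\<^sup>2) \<le> 201 * M ^ 3"
    by (simp add: power2_eq_square power3_eq_cube)
  have t3: "length ?V \<le> M ^ 3" "length (enc_tokens ts) \<le> M ^ 3"
    using V ts M3 by (simp_all add: M_def)
  \<comment> \<open>Symbolic execution needs the input word spelled out, while its length is folded
    back into \<open>N\<close> for the time bound.\<close>
  show ?thesis unfolding reduce_def w N_def[symmetric, unfolded w]
    apply (rule exec_mono)
     apply (rule block_POP, simp, simp)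
     apply (rule exec_block_Cons, rule load_vs)
     apply (rule block_POP, simp, simp)
     apply (rule block_POP, simp, simp)
     apply (rule exec_block_Cons, rule load_es)
     apply (rule block_POP, simp, simp)
     apply (rule block_shift[where w = "rev ?V" and r = "[]"],
       simp, simp add: image_subset_iff, simp add: image_iff, simp, simp)
     apply (rule block_PUSH, simp, simp)
     apply (rule exec_block_Cons, rule exec_vertices[OF vs ts])
     apply (rule block_put, simp, simp)
     apply (rule exec_block_Cons, rule exec_odd_names)
     apply (rule block_put, simp, simp)
     apply (rule exec_block_Cons, rule exec_zeros)
     apply (rule block_PUSH, simp, simp)
     apply (rule block_done)
     apply (simp add: enc_pair_def enc_list_def enc_nat_def bin_power o_def)
    apply (use t1 t2 t3 M3 in \<open>simp add: M_def[symmetric] del: mult_Suc_right\<close>)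
    done
qed

section \<open>The star of a graph\<close>

text \<open>Distinctness makes the index appear only once; a repeated index would list an interval
  twice and violate the disjointness in \<open>valid_intervals\<close>.\<close>

lemma occurrences_append_group:
  assumes "distinct g"
  shows "occurrences u j (map Some g @ ts) = (if u \<in> set g then [j] else []) @ occurrences u j ts"
  using assms by (induction g) auto

lemma filter_upt_Suc:
  "filter P [0..<Suc n] = (if P 0 then [0] else []) @ map Suc (filter (\<lambda>i. P (Suc i)) [0..<n])"
  by (simp add: upt_conv_Cons map_Suc_upt[symmetric] filter_map o_def del: upt_Suc)

text \<open>\<open>Suc\<close>, because a group's separator is counted before its names are reached:
  with \<open>j = 0\<close> the exponents start at 1.\<close>

lemma occurrences_tokens:
  assumes "\<forall>g\<in>set gs. distinct g"
  shows "occurrences u j (tokens gs) =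
    map (\<lambda>i. Suc (j + i)) (filter (\<lambda>i. u \<in> set (gs ! i)) [0..<length gs])"
  using assms
proof (induction gs arbitrary: j)
  case (Cons g gs)
  have "tokens (g # gs) = None # map Some g @ tokens gs" by (simp add: tokens_def)
  then show ?case
    using Cons by (simp add: occurrences_append_group filter_upt_Suc o_def del: upt_Suc)
qed (simp add: tokens_def)

lemma dyadic_intervals_disjoint:
  fixes x i j :: nat
  assumes "x \<in> {2 ^ i..<2 ^ Suc i}" "x \<in> {2 ^ j..<2 ^ Suc j}"
  shows "i = j"
proof -
  have "\<not> i < j" if "x \<in> {2 ^ i..<2 ^ Suc i}" "x \<in> {2 ^ j..<2 ^ Suc j}" for i j :: nat
  proof
    assume "i < j"
    then have "(2::nat) ^ Suc i \<le> 2 ^ j" by (intro power_increasing) auto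
    then show False using that by simp
  qed
  then show ?thesis using assms by (meson nat_neq_iff)
qed

lemma timesteps_star_edge:
  "timesteps (star_edge ts u) = (\<Union>j\<in>set (occurrences u 0 ts). {2 ^ j..<2 ^ Suc j})"
  by (auto simp: star_edge_def)

lemma overlap_star_edge:
  "overlap (star_edge ts u) (star_edge ts v) \<longleftrightarrow>
     set (occurrences u 0 ts) \<inter> set (occurrences v 0 ts) \<noteq> {}"
proof -
  have "(\<exists>t. t \<in> timesteps (star_edge ts u) \<and> t \<in> timesteps (star_edge ts v)) \<longleftrightarrow>
     set (occurrences u 0 ts) \<inter> set (occurrences v 0 ts) \<noteq> {}" (is "?L \<longleftrightarrow> ?R")
  proof
    assume ?L
    then obtain t :: nat and i j where "i \<in> set (occurrences u 0 ts)" "t \<in> {2 ^ i..<2 ^ Suc i}"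
      "j \<in> set (occurrences v 0 ts)" "t \<in> {2 ^ j..<2 ^ Suc j}"
      unfolding timesteps_star_edge by blast
    then show ?R using dyadic_intervals_disjoint[of t i j] by blast
  next
    assume ?R
    then obtain j where "j \<in> set (occurrences u 0 ts)" "j \<in> set (occurrences v 0 ts)" by auto
    \<comment> \<open>The left end of a common interval is a common timestep.\<close>
    moreover have "(2::nat) ^ j \<in> {2 ^ j..<2 ^ Suc j}" by simp
    ultimately show ?L unfolding timesteps_star_edge by blast
  qed
  then show ?thesis by (simp add: overlap_def star_edge_def)
qed

lemma valid_intervals_dyadic:
  assumes "js \<noteq> []" "distinct js" "\<forall>j\<in>set js. j < L"
  shows "valid_intervals (2 ^ L) (map (\<lambda>j. (2 ^ j, 2 ^ Suc j)) js)"
proof -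
  have "(2::nat) ^ Suc j \<le> 2 ^ L" if "j \<in> set js" for j
    using assms(3) that by (intro power_increasing) auto
  moreover have "{2 ^ (js ! i)..<(2::nat) ^ Suc (js ! i)} \<inter> {2 ^ (js ! i')..<2 ^ Suc (js ! i')} = {}"
    if "i < length js" "i' < length js" "i \<noteq> i'" for i i'
    using assms(2) that dyadic_intervals_disjoint by (fastforce simp: nth_eq_iff_index_eq)
  ultimately show ?thesis
    using assms(1) by (auto simp: valid_intervals_def disjoint_family_on_def)
qed

text \<open>The three symbols are the separator and the two brackets of one name. As exponents are
  at most the number of groups, the factor 3 keeps them strictly below the exponent of the
  lifetime.\<close>

lemma length_enc_tokens_ge:
  assumes "\<forall>g\<in>set gs. g \<noteq> []"
  shows "3 * length gs \<le> length (enc_tokens (tokens gs))"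
  using assms
proof (induction gs)
  case (Cons g gs)
  then obtain a g' where "g = a # g'" by (cases g) auto
  then show ?case using Cons by (simp add: tokens_def)
qed simp

locale graph_lists =
  fixes vs :: "nat list" and es :: "(nat \<times> nat) list"
  assumes distinct_vs: "distinct vs"
    and graph: "static_graph (set vs) (set (map (\<lambda>(u, v). {u, v}) es))"
begin

definition "ts = tokens (groups vs es)"

lemma distinct_groups: "\<forall>g\<in>set (groups vs es). distinct g"
proof -
  \<comment> \<open>A loop would give the group \<open>[u, u]\<close>, in which \<open>u\<close>
    occurs twice.\<close>
  have "(u, u) \<notin> set es" for u
  proof
    assume "(u, u) \<in> set es"
    then have "{u} \<in> set (map (\<lambda>(u, v). {u, v}) es)" by force
    then show False using graph by (auto simp: static_graph_def nsets_def)
  qed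
  then show ?thesis by (auto simp: groups_def)
qed

lemma occurrences_ts:
  "occurrences u 0 ts = map Suc (filter (\<lambda>i. u \<in> set (groups vs es ! i)) [0..<length (groups vs es)])"
  using occurrences_tokens[OF distinct_groups, of u 0] by (simp add: ts_def)

lemma common_occurrence_iff:
  "set (occurrences u 0 ts) \<inter> set (occurrences v 0 ts) \<noteq> {} \<longleftrightarrow>
     (\<exists>g\<in>set (groups vs es). u \<in> set g \<and> v \<in> set g)"
proof -
  have "set (occurrences w 0 ts) = Suc ` {i. i < length (groups vs es) \<and> w \<in> set (groups vs es ! i)}"
    for w by (auto simp: occurrences_ts)
  then have "set (occurrences u 0 ts) \<inter> set (occurrences v 0 ts) =
    Suc ` {i. i < length (groups vs es) \<and> u \<in> set (groups vs es ! i) \<and> v \<in> set (groups vs es ! i)}"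
    by auto
  then show ?thesis by (simp add: Bex_def in_set_conv_nth) blast
qed

text \<open>Distinct vertices never meet in a singleton group, so a common group comes from an edge,
  listed in one of its two directions.\<close>

lemma overlap_iff:
  assumes "u \<noteq> v"
  shows "overlap (star_edge ts u) (star_edge ts v) \<longleftrightarrow> {u, v} \<in> set (map (\<lambda>(u, v). {u, v}) es)"
proof -
  have "(\<exists>g\<in>set (groups vs es). u \<in> set g \<and> v \<in> set g) \<longleftrightarrow>
      (u, v) \<in> set es \<or> (v, u) \<in> set es" (is "?L \<longleftrightarrow> ?R")
  proof
    show "?L \<Longrightarrow> ?R" using assms by (auto simp: groups_def)
  next
    assume ?R
    then have "[v, u] \<in> set (groups vs es) \<or> [u, v] \<in> set (groups vs es)"
      by (force simp: groups_def)
    then show ?L by (meson list.set_intros)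
  qed
  also have "\<dots> \<longleftrightarrow> {u, v} \<in> set (map (\<lambda>(u, v). {u, v}) es)"
    by (force simp: doubleton_eq_iff image_iff)
  finally show ?thesis
    unfolding overlap_star_edge common_occurrence_iff .
qed

lemma inj_star_edge: "inj (star_edge ts)"
  by (auto simp: inj_def star_edge_def)

lemma valid_star_edge:
  assumes "u \<in> set vs"
  shows "valid_intervals (2 ^ length (enc_tokens ts)) (map (\<lambda>j. (2 ^ j, 2 ^ Suc j)) (rev (occurrences u 0 ts)))"
proof (rule valid_intervals_dyadic)
  have "[u] \<in> set (groups vs es)" using assms by (simp add: groups_def)
  \<comment> \<open>The criterion for a common group, taken with both vertices equal to
    \<open>u\<close>, shows that \<open>u\<close> occurs at all.\<close>
  then have "set (occurrences u 0 ts) \<inter> set (occurrences u 0 ts) \<noteq> {}"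
    unfolding common_occurrence_iff by (intro bexI[of _ "[u]"]) auto
  then show "rev (occurrences u 0 ts) \<noteq> []" by auto
  show "distinct (rev (occurrences u 0 ts))"
    by (simp add: occurrences_ts distinct_map)
  have "3 * length (groups vs es) \<le> length (enc_tokens ts)"
    unfolding ts_def by (rule length_enc_tokens_ge) (auto simp: groups_def)
  then show "\<forall>j\<in>set (rev (occurrences u 0 ts)). j < length (enc_tokens ts)"
    by (auto simp: occurrences_ts)
qed

definition "star_vertices = insert 0 ((\<lambda>v. Suc (2 * v)) ` set vs)"

definition "star_edges = star_edge ts ` set vs"

lemma temporal_graph_star:
  "temporal_graph star_vertices star_edges (2 ^ length (enc_tokens ts))"
proof -
  have "inj_on ends star_edges"
    by (auto simp: inj_on_def star_edges_def star_edge_def doubleton_eq_iff)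
  then show ?thesis
    using valid_star_edge
    by (auto simp: temporal_graph_def star_vertices_def star_edges_def star_edge_def)
qed

lemma encodes_star:
  "encodes_temporal_graph (enc_temporal_graph (2 ^ length (enc_tokens ts),
     0 # map (\<lambda>v. Suc (2 * v)) vs, map (star_edge ts) (rev vs)))
     star_vertices star_edges (2 ^ length (enc_tokens ts))"
  unfolding encodes_temporal_graph_def
  by (intro exI[of _ "0 # map (\<lambda>v. Suc (2 * v)) vs"] exI[of _ "map (star_edge ts) (rev vs)"])
    (use distinct_vs inj_star_edge in
      \<open>auto simp: star_vertices_def star_edges_def distinct_map inj_on_def\<close>)

lemma timed_matching_iff:
  assumes "I \<subseteq> set vs"
  shows "timed_matching star_edges (star_edge ts ` I) \<longleftrightarrow>
    indep I (set (map (\<lambda>(u, v). {u, v}) es))"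
proof -
  have "star_edge ts u \<noteq> star_edge ts v \<longleftrightarrow> u \<noteq> v" for u v
    using inj_star_edge by (auto simp: inj_def)
  then have "pairwise (\<lambda>e e'. \<not> overlap e e') (star_edge ts ` I) \<longleftrightarrow>
      (\<forall>u\<in>I. \<forall>v\<in>I. u \<noteq> v \<longrightarrow> \<not> overlap (star_edge ts u) (star_edge ts v))"
    by (simp add: pairwise_image pairwise_def)
  moreover have "star_edge ts ` I \<subseteq> star_edges"
    using assms by (auto simp: star_edges_def)
  ultimately show ?thesis
    unfolding timed_matching_def indep_def using overlap_iff by blast
qed

lemma has_independent_set_iff:
  "has_independent_set (set vs) (set (map (\<lambda>(u, v). {u, v}) es)) k \<longleftrightarrow>
     has_timed_matching star_edges k"
proof
  assume "has_independent_set (set vs) (set (map (\<lambda>(u, v). {u, v}) es)) k"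
  then obtain I where I: "I \<subseteq> set vs" "card I = k" "indep I (set (map (\<lambda>(u, v). {u, v}) es))"
    unfolding has_independent_set_def by blast
  moreover have "card (star_edge ts ` I) = card I"
    using inj_star_edge by (intro card_image) (auto simp: inj_on_def)
  ultimately show "has_timed_matching star_edges k"
    unfolding has_timed_matching_def using timed_matching_iff by blast
next
  assume "has_timed_matching star_edges k"
  then obtain M where M: "timed_matching star_edges M" "card M = k"
    unfolding has_timed_matching_def by blast
  \<comment> \<open>Every edge of the star belongs to a vertex, so any matching is the image of a
    vertex set.\<close>
  then obtain I where I: "I \<subseteq> set vs" "M = star_edge ts ` I"
    unfolding timed_matching_def star_edges_def by (meson subset_imageE)
  moreover have "card (star_edge ts ` I) = card I"
    using inj_star_edge by (intro card_image) (auto simp: inj_on_def)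
  ultimately show "has_independent_set (set vs) (set (map (\<lambda>(u, v). {u, v}) es)) k"
    unfolding has_independent_set_def using timed_matching_iff M by metis
qed

end

section \<open>The reduction\<close>

lemma computable_id: "computable (\<lambda>n. n)"
proof -
  have "computes_in SKIP [bin n] [bin n] 1" for n
    unfolding computes_in_def using run.Skip[of "input_store [bin n]"]
    by (intro exI[of _ "input_store [bin n]"]) simp
  then show ?thesis unfolding computable_def by blast
qed

lemma computable_1: "computable (\<lambda>_. 1)"
proof -
  define P where "P = block [shift 0 (range Some) [], PUSH 0 One]"
  have "exec P (st [bin n]) (6 * length (bin n) + 3)
      (st [bin 1])" for n
    unfolding P_def
    apply (rule exec_mono)
     apply (rule block_shift[where w = "bin n" and r = "[]"],
       simp, simp add: image_subset_iff, simp add: image_iff, simp, simp)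
     apply (rule block_PUSH, simp, simp)
     apply (rule block_done)
     apply (simp add: bin_1)
    apply simp
    done
  then have "\<exists>t. computes_in P [bin n] [bin 1] t" for n
    unfolding computes_in_def exec_def by (meson input_store_nth_ws)
  then show ?thesis unfolding computable_def by blast
qed

text \<open>The parameter factor will be the constant 1, so 1000 must go into the exponent:
  \<open>1000 <= 4 ^ 5 <= l ^ 5\<close> and \<open>Suc (2 * l) <= l ^ 2\<close> give 11 = 5 + 6. The
  bound 4 comes from the four list brackets of an encoded graph.\<close>

lemma cubic_time_le:
  fixes l :: nat
  assumes "4 \<le> l"
  shows "1000 * (Suc (2 * l)) ^ 3 \<le> l ^ 11"
proof -
  have "Suc (2 * l) \<le> 4 * l" using assms by simp
  also have "\<dots> \<le> l ^ 2" using assms by (simp add: power2_eq_square)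
  finally have "(Suc (2 * l)) ^ 3 \<le> (l ^ 2) ^ 3" by (rule power_mono) simp
  moreover have "1000 \<le> l ^ 5" using power_mono[OF assms, of 5] by simp
  ultimately have "1000 * (Suc (2 * l)) ^ 3 \<le> l ^ 5 * (l ^ 2) ^ 3" by (intro mult_mono) auto
  then show ?thesis by (simp add: power_mult[symmetric] power_add[symmetric])
qed

lemma computes_in_reduce:
  "\<exists>t. computes_in reduce [enc_graph (vs, es), bin k]
    [enc_temporal_graph (2 ^ length (enc_tokens (tokens (groups vs es))),
       0 # map (\<lambda>v. Suc (2 * v)) vs, map (star_edge (tokens (groups vs es))) (rev vs)), bin k] t \<and>
    t \<le> 1 * length (enc_graph (vs, es)) ^ 11"
proof -
  \<comment> \<open>Stacks beyond the listed ones are empty, so the two input words form a store of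
    ten stacks.\<close>
  have pad: "input_store [x, y] = st [x, y, [], [], [], [], [], [], [], []]" for x y
    by (auto simp: input_store_def fun_eq_iff nth_Cons split: nat.split)
  have "4 \<le> length (enc_graph (vs, es))" by (simp add: enc_pair_def enc_list_def)
  from exec_mono[OF exec_reduce[of vs es "bin k"] cubic_time_le[OF this]]
  obtain t where "t \<le> length (enc_graph (vs, es)) ^ 11" "run reduce (input_store [enc_graph (vs, es), bin k]) t
    (st [enc_temporal_graph (2 ^ length (enc_tokens (tokens (groups vs es))),
       0 # map (\<lambda>v. Suc (2 * v)) vs, map (star_edge (tokens (groups vs es))) (rev vs)), bin k,
       [], [], [], [], [], [], [], []])"
    unfolding exec_def pad by blast
  then show ?thesis
    unfolding computes_in_def
    by (intro exI[of _ t] conjI exI) (assumption, simp_all add: less_Suc_eq all_conj_distrib)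
qed

theorem theorem1:
  shows "\<exists>P. parameterized_reduction P independent_set_problem timed_matching_problem"
proof (intro exI)
  show "parameterized_reduction reduce independent_set_problem timed_matching_problem"
    unfolding parameterized_reduction_def
  proof (intro exI conjI ballI)
    show "computable (\<lambda>_. 1)" "computable (\<lambda>n. n)" by (fact computable_1 computable_id)+
  next
    fix wk assume "wk \<in> instances independent_set_problem"
    then obtain w k V E where wk: "wk = (w, k)" and VE: "static_graph V E" "encodes_graph w V E"
      by (auto simp: independent_set_problem_def)
    then obtain vs es where vs: "distinct vs" "set vs = V"
      and es: "set (map (\<lambda>(u, v). {u, v}) es) = E" and w: "w = enc_graph (vs, es)"
      unfolding encodes_graph_def by blast
    interpret graph_lists vs es
      by unfold_locales (use vs es VE in auto)
    define w' where "w' = enc_temporal_graph (2 ^ length (enc_tokens ts),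
      0 # map (\<lambda>v. Suc (2 * v)) vs, map (star_edge ts) (rev vs))"
    obtain t where t: "computes_in reduce [w, bin k] [w', bin k] t" "t \<le> 1 * length w ^ 11"
      using computes_in_reduce[of vs es k] unfolding w w'_def ts_def by blast
    have w'_encodes: "encodes_temporal_graph w' star_vertices star_edges (2 ^ length (enc_tokens ts))"
      unfolding w'_def by (rule encodes_star)
    have "(w, k) \<in> yes_instances independent_set_problem \<longleftrightarrow> has_independent_set V E k"
      using VE by (auto simp: independent_set_problem_def dest: encodes_graph_unique)
    moreover have "(w', k) \<in> yes_instances timed_matching_problem \<longleftrightarrow> has_timed_matching star_edges k"
      using w'_encodes temporal_graph_star
      by (auto simp: timed_matching_problem_def dest: encodes_temporal_graph_unique)
    moreover have "has_independent_set V E k \<longleftrightarrow> has_timed_matching star_edges k"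
      using has_independent_set_iff unfolding vs es .
    moreover have "(w', k) \<in> instances timed_matching_problem"
      using w'_encodes temporal_graph_star by (auto simp: timed_matching_problem_def)
    ultimately show "case wk of (x, k) \<Rightarrow> \<exists>x' k' t. computes_in reduce [x, bin k] [x', bin k'] t \<and>
      t \<le> 1 * length x ^ 11 \<and> (x', k') \<in> instances timed_matching_problem \<and>
      ((x, k) \<in> yes_instances independent_set_problem \<longleftrightarrow>
       (x', k') \<in> yes_instances timed_matching_problem) \<and> k' \<le> k"
      using t wk by auto
  qed
qed

end
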